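(* Let $S_1,\dots,S_n$ be numerical semigroups. Then $$\langle\{S_1,\dots,S_n\}\rangle=\Big\{\bigcap_{b\in B}T_b\ \Big|\ \emptyset\neq B\subseteq\{1,\dots,n\}\text{ and }T_b\in \mathrm{Cad}(S_b)\text{ for all }b\in B\Big\}.$$
   Context: Let $\mathbb{N}=\{0,1,2,\dots\}$. A numerical semigroup is a subset $S\subseteq\mathbb{N}$ that contains $0$, is closed under addition, and has finite complement $\mathbb{N}\setminus S$. Its multiplicity is $m(S)=\min(S\setminus\{0\})$ and its Frobenius number is $F(S)=\max\{z\in\mathbb{Z}\mid z\notin S\}$. A covariety is a nonempty family $\mathcal{C}$ of numerical semigroups such that: (1) $\mathcal{C}$ has a minimum $\Delta(\mathcal{C})=\min(\mathcal{C})$ with respect to set inclusion; (2) if $S,T\in\mathcal{C}$ then $S\cap T\in\mathcal{C}$; (3) if $S\in\mathcal{C}$ and $S\neq\Delta(\mathcal{C})$ then $S\setminus\{m(S)\}\in\mathcal{C}$. Given numerical semigroups $S_1,\dots,S_n$, let $F=\max\{F(S_1),\dots,F(S_n)\}$ and $\Delta=\{0\}\cup\{z\in\mathbb{N}\mid z\geq F+1\}$. $\langle\{S_1,\dots,S_n\}\rangle$ denotes the intersection of all covarieties that contain $\{S_1,\dots,S_n\}$ and have $\Delta$ as minimum. For each $i\in\{1,\dots,n\}$ define recursively $S_i^0=S_i$ and, for $k\geq 0$, $S_i^{k+1}=S_i^k\setminus\{m(S_i^k)\}$ if $S_i^k\neq\Delta$, and $S_i^{k+1}=\Delta$ otherwise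 (superscripts are indices). Let $P_i=\min\{k\in\mathbb{N}\mid S_i^k=\Delta\}$, which exists, and set $\mathrm{Cad}(S_i)=\{S_i^0,\dots,S_i^{P_i}\}$. *)

theory Defs
  imports Main
begin

definition numerical_semigroup :: "nat set \<Rightarrow> bool" where
  "numerical_semigroup S \<longleftrightarrow>
     0 \<in> S \<and> (\<forall>x\<in>S. \<forall>y\<in>S. x + y \<in> S) \<and> finite (UNIV - S)"

definition multiplicity :: "nat set \<Rightarrow> nat" where
  "multiplicity S = (LEAST x. x \<in> S - {0})"

text \<open>
  The maximum is taken over the integers, so the Frobenius number of \<open>UNIV\<close> is \<open>-1\<close>. It is
  written with \<open>GREATEST\<close>, because \<open>Max\<close> is only meaningful on finite sets and all negative
  integers are outside \<open>S\<close>.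
\<close>
definition frobenius :: "nat set \<Rightarrow> int" where
  "frobenius S = (GREATEST z::int. z \<notin> int ` S)"

text \<open>The order on sets is inclusion, so this is the minimum of the family, if there is one.\<close>
definition family_min :: "nat set set \<Rightarrow> nat set" where
  "family_min C = (LEAST D. D \<in> C)"

definition covariety :: "nat set set \<Rightarrow> bool" where
  "covariety C \<longleftrightarrow>
     C \<noteq> {} \<and> (\<forall>S\<in>C. numerical_semigroup S) \<and>
     (\<exists>D\<in>C. \<forall>S\<in>C. D \<subseteq> S) \<and>
     (\<forall>S\<in>C. \<forall>T\<in>C. S \<inter> T \<in> C) \<and>
     (\<forall>S\<in>C. S \<noteq> family_min C \<longrightarrow> S - {multiplicity S} \<in> C)"

definition Delta :: "nat set set \<Rightarrow> nat set" where
  "Delta X = {0} \<union> {z. int z \<ge> Max (frobenius ` X) + 1}"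

definition generated_covariety :: "nat set set \<Rightarrow> nat set set" where
  "generated_covariety X = \<Inter>{C. covariety C \<and> X \<subseteq> C \<and> family_min C = Delta X}"

primrec cad_seq :: "nat set \<Rightarrow> nat set \<Rightarrow> nat \<Rightarrow> nat set" where
  "cad_seq D S 0 = S"
| "cad_seq D S (Suc k) =
     (if cad_seq D S k \<noteq> D then cad_seq D S k - {multiplicity (cad_seq D S k)} else D)"

definition cad_length :: "nat set \<Rightarrow> nat set \<Rightarrow> nat" where
  "cad_length D S = (LEAST k. cad_seq D S k = D)"

definition Cad :: "nat set \<Rightarrow> nat set \<Rightarrow> nat set set" where
  "Cad D S = cad_seq D S ` {0..cad_length D S}"

end

theory Submission
  imports Defs
begin

text \<open>
  Removing the multiplicity repeatedly from \<open>S\<close> until \<open>\<Delta> = {0, c, c + 1, \<dots>}\<close> is reached runs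
  exactly through the truncations \<open>{0} \<union> (S \<inter> {a, a + 1, \<dots>})\<close> with \<open>a \<le> c\<close>. An intersection of
  truncations of the \<open>S\<^sub>b\<close> is the truncation of \<open>\<Inter>\<^sub>b S\<^sub>b\<close> at the largest of the bounds, so the
  right-hand side consists of the truncations of the intersections \<open>\<Inter>\<^sub>b S\<^sub>b\<close>. In this form it is
  visibly a covariety with minimum \<open>\<Delta>\<close>; conversely a covariety with minimum \<open>\<Delta>\<close> that contains
  \<open>S\<^sub>b\<close> contains \<open>Cad (S\<^sub>b)\<close>, and it is closed under finite intersections.
\<close>

section \<open>Truncations of a set and the removal of its multiplicity\<close>

definition truncate :: "nat set \<Rightarrow> nat \<Rightarrow> nat set" where
  "truncate S a = insert 0 {x \<in> S. a \<le> x}"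

lemma truncate_0: "0 \<in> S \<Longrightarrow> truncate S 0 = S"
  by (auto simp: truncate_def)

lemma truncate_Int:
  "truncate S a \<inter> truncate T b = truncate (S \<inter> T) (max a b)"
  by (auto simp: truncate_def)

lemma truncate_INT:
  assumes "finite B" "B \<noteq> {}"
  shows "(\<Inter>b\<in>B. truncate (S b) (a b)) = truncate (\<Inter>b\<in>B. S b) (Max (a ` B))"
  using assms by (auto simp: truncate_def)

lemma truncate_eq_min:
  assumes "insert 0 {c..} \<subseteq> S"
  shows "truncate S c = insert 0 {c..}"
  using assms by (auto simp: truncate_def)

lemma min_subset_truncate:
  assumes "insert 0 {c..} \<subseteq> S" "a \<le> c"
  shows "insert 0 {c..} \<subseteq> truncate S a"
  using assms by (auto simp: truncate_def)

text \<open>Sums of elements that are at least \<open>a\<close> are at least \<open>a\<close>, and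
  all gaps lie below \<open>c\<close>. Only additive closure of \<open>S\<close> is asked for, so
  the lemma applies directly to intersections of semigroups.\<close>

lemma numerical_semigroup_truncate:
  assumes add: "\<And>x y. x \<in> S \<Longrightarrow> y \<in> S \<Longrightarrow> x + y \<in> S"
    and "insert 0 {c..} \<subseteq> S" "a \<le> c"
  shows "numerical_semigroup (truncate S a)"
proof -
  have "UNIV - truncate S a \<subseteq> {..<c}"
    using min_subset_truncate[OF assms(2,3)] by (auto simp: subset_iff simp flip: not_le)
  then have "finite (UNIV - truncate S a)"
    using finite_subset by blast
  then show ?thesis
    using add by (auto simp: numerical_semigroup_def truncate_def)
qed

lemma truncate_remove_multiplicity:
  assumes "insert 0 {c..} \<subseteq> S" "a \<le> c" "truncate S a \<noteq> insert 0 {c..}"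
  obtains a' where "a' \<le> c"
    and "truncate S a - {multiplicity (truncate S a)} = truncate S a'"
proof -
  let ?T = "truncate S a"
  define m where "m = multiplicity ?T"
  \<comment> \<open>Being different from \<open>insert 0 {c..}\<close>, the truncation has a nonzero
    element below \<open>c\<close>. It shows that the \<open>LEAST\<close> in
    \<open>multiplicity\<close> is attained and that the new bound \<open>Suc m\<close> does not
    exceed \<open>c\<close>.\<close>
  obtain x where x: "x \<in> ?T - {0}" "x < c"
    using min_subset_truncate[OF assms(1,2)] assms(3) by fastforce
  have m: "m \<in> ?T - {0}"
    unfolding m_def multiplicity_def using x(1) by (rule LeastI)
  have least: "m \<le> y" if "y \<in> ?T - {0}" for y
    unfolding m_def multiplicity_def using that by (rule Least_le)
  have "?T - {m} = truncate S (Suc m)"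
    using m least by (fastforce simp: truncate_def)
  moreover have "Suc m \<le> c"
    using least[OF x(1)] x(2) by simp
  ultimately show thesis
    using that m_def by blast
qed

section \<open>The chain \<open>Cad\<close> as a set of truncations\<close>

lemma multiplicity_truncate:
  assumes "a \<in> S" "a \<noteq> 0"
  shows "multiplicity (truncate S a) = a"
  unfolding multiplicity_def
  by (rule Least_equality) (use assms in \<open>auto simp: truncate_def\<close>)

text \<open>Taking the whole range avoids counting steps. Each removal yields a truncation with
  another bound up to \<open>c\<close>; conversely, induction on the bound shows that none is
  skipped.\<close>

lemma range_cad_seq:
  assumes D: "insert 0 {c..} \<subseteq> S"
  shows "range (cad_seq (insert 0 {c..}) S) = truncate S ` {..c}"
proof
  let ?D = "insert 0 {c..}"
  have "cad_seq ?D S k \<in> truncate S ` {..c}" for k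
  proof (induction k)
    case 0
    have "truncate S 0 = S"
      using D by (intro truncate_0) auto
    then show ?case
      by (metis atMost_iff cad_seq.simps(1) image_eqI le0)
  next
    case (Suc k)
    then obtain a where a: "a \<le> c" "cad_seq ?D S k = truncate S a"
      by auto
    show ?case
    proof (cases "truncate S a = ?D")
      case True
      then show ?thesis
        using Suc a(2) by simp
    next
      case False
      then obtain a' where "a' \<le> c"
          "truncate S a - {multiplicity (truncate S a)} = truncate S a'"
        using truncate_remove_multiplicity[OF D a(1)] by blast
      then show ?thesis
        using a(2) False by simp
    qed
  qed
  then show "range (cad_seq ?D S) \<subseteq> truncate S ` {..c}"
    by blast
next
  let ?D = "insert 0 {c..}"
  have "a \<le> c \<Longrightarrow> \<exists>k. cad_seq ?D S k = truncate S a" for a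
  proof (induction a)
    case 0
    have "cad_seq ?D S 0 = truncate S 0"
      using D by (simp add: truncate_0)
    then show ?case ..
  next
    case (Suc a)
    then obtain k where k: "cad_seq ?D S k = truncate S a"
      by auto
    show ?case
    \<comment> \<open>If \<open>a\<close> is a nonzero element of \<open>S\<close>, it is the
      multiplicity of \<open>truncate S a\<close>, so one more step gives the bound
      \<open>Suc a\<close>. Otherwise both truncations coincide and the same \<open>k\<close>
      serves.\<close>
    proof (cases "a \<in> S \<and> a \<noteq> 0")
      case True
      then have "a \<in> truncate S a" "a \<notin> ?D"
        using Suc.prems by (auto simp: truncate_def)
      then have "cad_seq ?D S (Suc k) = truncate S a - {a}"
        using k True multiplicity_truncate by auto
      also have "\<dots> = truncate S (Suc a)"
        using True by (auto simp: truncate_def)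
      finally show ?thesis ..
    next
      case False
      then have "truncate S (Suc a) = truncate S a"
        by (auto simp: truncate_def Suc_le_eq le_less)
      then show ?thesis
        using k by auto
    qed
  qed
  then show "truncate S ` {..c} \<subseteq> range (cad_seq ?D S)"
    by (metis atMost_iff image_subsetI rangeI)
qed

text \<open>Once \<open>D\<close> is reached the sequence stays there, so indices beyond
  \<open>cad_length D S\<close> add nothing. The hypothesis guarantees that the \<open>LEAST\<close>
  in \<open>cad_length\<close> is attained.\<close>

lemma Cad_eq_range:
  assumes "cad_seq D S p = D"
  shows "Cad D S = range (cad_seq D S)"
proof -
  let ?P = "cad_length D S"
  have P: "cad_seq D S ?P = D"
    unfolding cad_length_def using assms by (rule LeastI)
  have "cad_seq D S (?P + j) = D" for j
    by (induction j) (simp_all add: P)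
  then have "cad_seq D S k \<in> Cad D S" for k
    unfolding Cad_def using P
    by (metis atLeastAtMost_iff image_eqI le0 le_add_diff_inverse nle_le)
  then show ?thesis
    unfolding Cad_def by blast
qed

lemma Cad_eq_truncate:
  assumes "insert 0 {c..} \<subseteq> S"
  shows "Cad (insert 0 {c..}) S = truncate S ` {..c}"
proof -
  have "insert 0 {c..} \<in> range (cad_seq (insert 0 {c..}) S)"
    using range_cad_seq[OF assms] truncate_eq_min[OF assms]
    by (metis atMost_iff image_eqI order_refl)
  then obtain p where "cad_seq (insert 0 {c..}) S p = insert 0 {c..}"
    by (metis rangeE)
  then show ?thesis
    using Cad_eq_range range_cad_seq[OF assms] by metis
qed

section \<open>Frobenius numbers and \<open>Delta\<close>\<close>

lemma frobenius_upper:
  assumes "numerical_semigroup S" "z \<notin> int ` S"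
  shows "z \<le> frobenius S"
proof -
  \<comment> \<open>The element \<open>- 1\<close> stands for all negative integers and keeps the
    set nonempty when \<open>S\<close> is \<open>UNIV\<close>.\<close>
  let ?A = "insert (- 1) (int ` (UNIV - S))"
  have fin: "finite ?A"
    using assms(1) by (simp add: numerical_semigroup_def)
  have bound: "y \<le> Max ?A" if "y \<notin> int ` S" for y
  proof (cases "y < 0")
    case True
    then show ?thesis
      using Max_ge[OF fin, of "- 1"] by simp
  next
    case False
    then have "y \<in> ?A"
      using that by (metis DiffI UNIV_I image_eqI insertCI int_nat_eq linorder_not_le)
    then show ?thesis
      using Max_ge[OF fin] by blast
  qed
  have "Max ?A \<in> ?A"
    using fin by (intro Max_in) auto
  then have "Max ?A \<notin> int ` S"
    by auto
  then have "frobenius S = Max ?A"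
    unfolding frobenius_def using bound by (rule Greatest_equality)
  then show ?thesis
    using bound assms(2) by simp
qed

lemma Delta_eq:
  assumes "finite X" "X \<noteq> {}" "\<And>S. S \<in> X \<Longrightarrow> numerical_semigroup S"
  obtains c where "Delta X = insert 0 {c..}"
    and "\<And>S. S \<in> X \<Longrightarrow> insert 0 {c..} \<subseteq> S"
proof
  let ?M = "Max (frobenius ` X)"
  \<comment> \<open>If every Frobenius number is \<open>-1\<close>, the bound is \<open>0\<close>
    and \<open>Delta X\<close> is \<open>UNIV\<close>.\<close>
  show eq: "Delta X = insert 0 {nat (?M + 1)..}"
    unfolding Delta_def by auto
  fix S
  assume S: "S \<in> X"
  have "z \<in> S" if "int z \<ge> ?M + 1" for z
  proof (rule ccontr)
    assume "z \<notin> S"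
    then have "int z \<le> frobenius S"
      by (intro frobenius_upper assms(3) S) auto
    also have "\<dots> \<le> ?M"
      using assms(1) S by simp
    finally show False
      using that by simp
  qed
  moreover have "0 \<in> S"
    using assms(3)[OF S] by (simp add: numerical_semigroup_def)
  ultimately show "insert 0 {nat (?M + 1)..} \<subseteq> S"
    unfolding eq[symmetric] by (auto simp: Delta_def)
qed

section \<open>Covarieties and the generated family\<close>

lemma family_min_eqI:
  assumes "D \<in> C" "\<And>S. S \<in> C \<Longrightarrow> D \<subseteq> S"
  shows "family_min C = D"
  unfolding family_min_def by (rule Least_equality) (use assms in auto)

text \<open>With \<open>D\<close> the minimum of \<open>C\<close>, the test in
  \<open>cad_seq\<close> is exactly the condition under which a covariety allows removing the
  multiplicity.\<close>

lemma covariety_cad_seq: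
  assumes "covariety C" "S \<in> C"
  shows "cad_seq (family_min C) S k \<in> C"
  by (induction k) (use assms in \<open>auto simp: covariety_def\<close>)

lemma covariety_INT:
  assumes "covariety C" "finite B" "B \<noteq> {}" "\<And>b. b \<in> B \<Longrightarrow> T b \<in> C"
  shows "(\<Inter>b\<in>B. T b) \<in> C"
  using assms(2-4)
proof (induction B rule: finite_ne_induct)
  case (insert b B)
  then show ?case
    using assms(1) by (simp add: covariety_def)
qed simp

theorem proposition5p6:
  fixes n :: nat and S :: "nat \<Rightarrow> nat set"
  assumes "n \<ge> 1"
    and "\<And>i. i \<in> {1..n} \<Longrightarrow> numerical_semigroup (S i)"
  shows "generated_covariety (S ` {1..n}) =
    {\<Inter>b\<in>B. T b | B T. B \<noteq> {} \<and> B \<subseteq> {1..n} \<and>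
       (\<forall>b\<in>B. T b \<in> Cad (Delta (S ` {1..n})) (S b))}"
    (is "_ = ?R")
proof -
  let ?I = "{1..n}"
  have "S ` ?I \<noteq> {}" "\<And>U. U \<in> S ` ?I \<Longrightarrow> numerical_semigroup U"
    using assms by auto
  then obtain c where Delta: "Delta (S ` ?I) = insert 0 {c..}"
    and "\<And>U. U \<in> S ` ?I \<Longrightarrow> insert 0 {c..} \<subseteq> U"
    using Delta_eq[of "S ` ?I"] by blast
  then have c: "\<And>b. b \<in> ?I \<Longrightarrow> insert 0 {c..} \<subseteq> S b"
    by blast
  let ?D = "insert 0 {c..}"
  have Cad: "Cad ?D (S b) = truncate (S b) ` {..c}" if "b \<in> ?I" for b
    using Cad_eq_truncate[OF c[OF that]] .
  define meet where "meet B = (\<Inter>b\<in>B. S b)" for B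
  have meet_min: "?D \<subseteq> meet B" if "B \<subseteq> ?I" for B
    using c that unfolding meet_def by blast
  define R where "R = {truncate (meet B) a | B a. B \<noteq> {} \<and> B \<subseteq> ?I \<and> a \<le> c}"
  have R_I: "truncate (meet B) a \<in> R" if "B \<noteq> {}" "B \<subseteq> ?I" "a \<le> c" for B a
    unfolding R_def using that by blast
  have R_cases: thesis
    if "U \<in> R"
      and "\<And>B a. B \<subseteq> ?I \<Longrightarrow> a \<le> c \<Longrightarrow> U = truncate (meet B) a \<Longrightarrow> B \<noteq> {} \<Longrightarrow> thesis"
    for U thesis
    using that unfolding R_def by blast
  \<comment> \<open>Different bounds for the \<open>S b\<close> merge into their maximum; conversely
    one bound is used for every \<open>b\<close>.\<close>
  have R_eq: "?R = R"
  proof (intro equalityI subsetI)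
    fix U
    assume "U \<in> ?R"
    then obtain B T where B: "B \<noteq> {}" "B \<subseteq> ?I" and U: "U = (\<Inter>b\<in>B. T b)"
      and T: "\<forall>b\<in>B. T b \<in> Cad ?D (S b)"
      unfolding Delta by blast
    have "\<forall>b\<in>B. \<exists>a\<le>c. T b = truncate (S b) a"
      using T Cad B(2) by blast
    then obtain a where a: "\<And>b. b \<in> B \<Longrightarrow> a b \<le> c \<and> T b = truncate (S b) (a b)"
      by metis
    have fin: "finite B"
      using B(2) finite_subset by blast
    have "U = truncate (meet B) (Max (a ` B))"
      unfolding U meet_def truncate_INT[OF fin B(1), symmetric] using a by simp
    moreover have "Max (a ` B) \<le> c"
      using fin B(1) a by simp
    ultimately show "U \<in> R"
      using R_I[OF B] by simp
  next
    fix U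
    assume "U \<in> R"
    then obtain B a where B: "B \<subseteq> ?I" and a: "a \<le> c" and U: "U = truncate (meet B) a"
      and ne: "B \<noteq> {}"
      by (rule R_cases)
    have "finite B"
      using B finite_subset by blast
    then have "U = (\<Inter>b\<in>B. truncate (S b) a)"
      using ne truncate_INT[of B S "\<lambda>_. a"] by (simp add: U meet_def)
    moreover have "\<forall>b\<in>B. truncate (S b) a \<in> Cad ?D (S b)"
      using Cad B a by blast
    ultimately show "U \<in> ?R"
      unfolding Delta using B ne by blast
  qed
  have min_least: "?D \<subseteq> U" if U: "U \<in> R" for U
  proof -
    obtain B a where B: "B \<subseteq> ?I" "a \<le> c" "U = truncate (meet B) a" "B \<noteq> {}"
      using U by (rule R_cases)
    show ?thesis
      unfolding B(3) by (rule min_subset_truncate[OF meet_min[OF B(1)] B(2)])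
  qed
  have min_in: "?D \<in> R"
  proof -
    have "?D = truncate (meet ?I) c"
      by (rule truncate_eq_min[OF meet_min, symmetric]) simp
    then show ?thesis
      using R_I[of ?I c] assms(1) by simp
  qed
  \<comment> \<open>This comes before \<open>covariety R\<close> because the removal condition
    refers to \<open>family_min R\<close>.\<close>
  have fmin: "family_min R = ?D"
    using min_in min_least by (rule family_min_eqI)
  have ns: "numerical_semigroup U" if U: "U \<in> R" for U
  proof -
    obtain B a where B: "B \<subseteq> ?I" "a \<le> c" "U = truncate (meet B) a" "B \<noteq> {}"
      using U by (rule R_cases)
    have "x + y \<in> meet B" if "x \<in> meet B" "y \<in> meet B" for x y
      using that assms(2) B(1) unfolding meet_def numerical_semigroup_def by blast
    then show ?thesis
      unfolding B(3) by (rule numerical_semigroup_truncate[OF _ meet_min[OF B(1)] B(2)])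
  qed
  have Int_in: "U \<inter> V \<in> R" if UV: "U \<in> R" "V \<in> R" for U V
  proof -
    obtain B a where B: "B \<subseteq> ?I" "a \<le> c" "U = truncate (meet B) a" "B \<noteq> {}"
      using UV(1) by (rule R_cases)
    obtain B' a' where B': "B' \<subseteq> ?I" "a' \<le> c" "V = truncate (meet B') a'" "B' \<noteq> {}"
      using UV(2) by (rule R_cases)
    have "U \<inter> V = truncate (meet (B \<union> B')) (max a a')"
      unfolding B(3) B'(3) truncate_Int meet_def by (simp add: INT_Un)
    then show ?thesis
      using R_I[of "B \<union> B'" "max a a'"] B B' by simp
  qed
  have remove_in: "U - {multiplicity U} \<in> R" if U: "U \<in> R" "U \<noteq> ?D" for U
  proof -
    obtain B a where B: "B \<subseteq> ?I" "a \<le> c" "U = truncate (meet B) a" "B \<noteq> {}"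
      using U(1) by (rule R_cases)
    obtain a' where "a' \<le> c" "U - {multiplicity U} = truncate (meet B) a'"
      using truncate_remove_multiplicity[OF meet_min[OF B(1)] B(2)] U(2)
      unfolding B(3) by blast
    then show ?thesis
      using R_I[OF B(4,1)] by simp
  qed
  have "covariety R"
    unfolding covariety_def fmin
    by (intro conjI ballI impI bexI[OF _ min_in] min_least ns Int_in remove_in)
      (use min_in in blast)+
  moreover have "S ` ?I \<subseteq> R"
  proof (rule image_subsetI)
    fix b
    assume b: "b \<in> ?I"
    then have "S b = truncate (meet {b}) 0"
      using c by (simp add: meet_def truncate_0)
    then show "S b \<in> R"
      using R_I[of "{b}" 0] b by simp
  qed
  \<comment> \<open>\<open>R\<close> is itself one of the families being intersected.\<close>
  ultimately have "generated_covariety (S ` ?I) \<subseteq> R"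
    unfolding generated_covariety_def using fmin Delta by blast
  moreover have "R \<subseteq> C"
    if C: "covariety C" "S ` ?I \<subseteq> C" "family_min C = Delta (S ` ?I)" for C
  proof
    fix U
    assume "U \<in> R"
    then have "U \<in> ?R"
      by (simp only: R_eq)
    then obtain B T where B: "B \<noteq> {}" "B \<subseteq> ?I" and U: "U = (\<Inter>b\<in>B. T b)"
      and T: "\<forall>b\<in>B. T b \<in> Cad (Delta (S ` ?I)) (S b)"
      by blast
    \<comment> \<open>\<open>Cad\<close> is taken with respect to \<open>Delta\<close>, which is
      \<open>family_min C\<close>, so its members are terms of a sequence that stays in
      \<open>C\<close>.\<close>
    have "T b \<in> C" if "b \<in> B" for b
      using T that B(2) C(2) covariety_cad_seq[OF C(1), of "S b"] C(3)
      unfolding Cad_def by fastforce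
    moreover have "finite B"
      using B(2) finite_subset by blast
    ultimately show "U \<in> C"
      unfolding U using covariety_INT[OF C(1)] B(1) by blast
  qed
  then have "R \<subseteq> generated_covariety (S ` ?I)"
    unfolding generated_covariety_def by (intro Inter_greatest) blast
  ultimately show ?thesis
    unfolding R_eq by (rule equalityI)
qed

end
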